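(* Let $q$ be an odd prime power, let $d\ge2$, let $Q$ be a nondegenerate quadratic form on $\mathbb F_q^d$, let $P\subseteq\mathbb F_q^d$ be nonempty and let $T\subseteq\mathbb F_q^d$ be a set of $m\ge2$ pins. Suppose $$|\Delta_p^Q(P)|\le(1-\alpha)q\qquad(p\in T)$$ for some $0<\alpha<1$, and suppose that for some $C_1\ge1$, $$(1-\alpha)^3mq^3\le C_1^2\alpha^2|P|.$$ Then there exist distinct pins $p,p'\in T$ and attained radii $t\in\Delta_p^Q(P)$, $t'\in\Delta_{p'}^Q(P)$ for which $$|P\cap S_Q(p,t)\cap S_Q(p',t')|\ge\frac{\alpha}{8C_1\sqrt{1-\alpha}}\sqrt{\frac{m|P|}q}.\tag{*}$$ The same lower bound holds for $|P\cap H|$, where $H$ is the corresponding radical hyperplane of $S_Q(p,t)$ and $S_Q(p',t')$. Moreover, at least $$\frac{3|P|m(m-1)}{4q^{d-1}}$$ ordered choices $((p,t),(p',t'))$ (with $p\ne p'$ in $T$, $t\in\Delta_p^Q(P)$, $t'\in\Delta_{p'}^Q(P)$) satisfy ( * ); if $d\ge3$, the lower bound improves to $$\frac{3|P|m(m-1)}{8q^{d-2}}.$$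
   Context: $\Delta_p^Q(P)=\{Q(x-p):x\in P\}$ and $S_Q(c,r)=\{x\in\mathbb F_q^d:Q(x-c)=r\}$. With $\langle x,y\rangle_Q=\frac{Q(x+y)-Q(x)-Q(y)}2$, the radical hyperplane of $S_Q(c,r)$ and $S_Q(c',r')$, $c\ne c'$, is $\{x\in\mathbb F_q^d:2\langle c'-c,x\rangle_Q=(r-r')-Q(c)+Q(c')\}$. *)

theory Defs
  imports "HOL-Analysis.Finite_Cartesian_Product"
begin

text \<open>A quadratic form is a homogeneous polynomial function of degree two in the coordinates.\<close>

definition quadratic_form :: "('a::field ^ 'n \<Rightarrow> 'a) \<Rightarrow> bool" where
  "quadratic_form Q \<longleftrightarrow>
     (\<exists>A :: 'a ^ 'n ^ 'n. \<forall>x. Q x = (\<Sum>i\<in>UNIV. \<Sum>j\<in>UNIV. A $ i $ j * x $ i * x $ j))"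

text \<open>The division by two makes this the usual form only in characteristic other than two;
  in characteristic two it is identically zero.\<close>

definition polar :: "('a::field ^ 'n \<Rightarrow> 'a) \<Rightarrow> 'a ^ 'n \<Rightarrow> 'a ^ 'n \<Rightarrow> 'a" where
  "polar Q x y = (Q (x + y) - Q x - Q y) / 2"

definition nondegenerate :: "('a::field ^ 'n \<Rightarrow> 'a) \<Rightarrow> bool" where
  "nondegenerate Q \<longleftrightarrow> (\<forall>x. (\<forall>y. polar Q x y = 0) \<longrightarrow> x = 0)"

definition pinned_distances ::
    "('a::field ^ 'n \<Rightarrow> 'a) \<Rightarrow> ('a ^ 'n) set \<Rightarrow> 'a ^ 'n \<Rightarrow> 'a set" where
  "pinned_distances Q P p = {Q (x - p) | x. x \<in> P}"

definition qsphere :: "('a::field ^ 'n \<Rightarrow> 'a) \<Rightarrow> 'a ^ 'n \<Rightarrow> 'a \<Rightarrow> ('a ^ 'n) set" where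
  "qsphere Q c r = {x. Q (x - c) = r}"

text \<open>The radical hyperplane of \<open>qsphere Q c r\<close> and \<open>qsphere Q c' r'\<close>; it is a hyperplane
  only for \<open>c \<noteq> c'\<close>. It depends on the centres and radii rather than on the spheres as point
  sets.\<close>

definition radical_hyperplane ::
    "('a::field ^ 'n \<Rightarrow> 'a) \<Rightarrow> 'a ^ 'n \<Rightarrow> 'a \<Rightarrow> 'a ^ 'n \<Rightarrow> 'a \<Rightarrow> ('a ^ 'n) set" where
  "radical_hyperplane Q c r c' r' = {x. 2 * polar Q (c' - c) x = (r - r') - Q c + Q c'}"

end

theory Submission
  imports Defs "HOL-Computational_Algebra.Polynomial" "HOL-Number_Theory.Residues"
begin

text \<open>Each point of \<open>P\<close> lies on exactly one sphere around every pin, so the sizes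
  of the intersections \<open>P \<inter> S(p, t) \<inter> S(p', t')\<close> add up to \<open>\<bar>P\<bar> m (m - 1)\<close>, while there are at
  most \<open>(1 - \<alpha>)\<^sup>2 q\<^sup>2 m (m - 1)\<close> of them. The hypothesis on \<open>C\<^sub>1\<close> says that the required lower bound is
  at most one eighth of the resulting average, so the intersections below that bound account
  for at most an eighth of the total. Each of the others lies in a hyperplane, and for \<open>d \<ge> 3\<close> in a
  proper quadric of that hyperplane because a nondegenerate form does not vanish on a hyperplane;
  hence it has at most \<open>q\<^bsup>d-1\<^esup>\<close>, respectively \<open>2 q\<^bsup>d-2\<^esup>\<close>, points.\<close>

section \<open>Odd characteristic and elementary counting\<close>

lemma two_neq_zero_of_odd_card:
  assumes "odd CARD('a::{field,finite})"
  shows "(2::'a) \<noteq> 0"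
proof
  assume "(2::'a) = 0"
  then have "of_nat 2 = (0::'a)" by simp
  then have "CHAR('a) dvd 2" by (simp only: of_nat_eq_0_iff_char_dvd)
  \<comment> \<open>The characteristic divides the order of the field, so it is odd as well; being a
    divisor of 2, it would have to be 1.\<close>
  moreover have "odd CHAR('a)"
    using assms CHAR_dvd_CARD[where 'a = 'a] dvd_trans by blast
  moreover have "CHAR('a) = 1 \<or> CHAR('a) = 2"
    using \<open>CHAR('a) dvd 2\<close> two_is_prime_nat prime_nat_iff by blast
  ultimately have "CHAR('a) = 1" by auto
  then show False
    using CHAR_not_1' by auto
qed

lemma card_le_mult_fibres:
  assumes "finite A" "finite B" "g ` A \<subseteq> B"
    and "\<And>y. y \<in> B \<Longrightarrow> card {x \<in> A. g x = y} \<le> k"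
  shows "card A \<le> k * card B"
proof -
  have "card A = (\<Sum>y\<in>B. card {x \<in> A. g x = y})"
    using sum.group[OF assms(1-3), of "\<lambda>_. 1::nat"] by simp
  also have "\<dots> \<le> (\<Sum>y\<in>B. k)"
    by (intro sum_mono assms(4))
  finally show ?thesis by (simp add: mult.commute)
qed

text \<open>Split the sum at the level \<open>L\<close>: a value below \<open>L\<close> contributes
  at most \<open>L\<close>, any other at most \<open>B\<close>. Hence a large sum forces many values
  of at least \<open>L\<close>.\<close>

lemma card_large_values_ge:
  fixes w :: "'b \<Rightarrow> real" and L B :: real
  assumes "finite Z" "0 \<le> L"
    and "\<And>z. z \<in> Z \<Longrightarrow> w z \<le> B"
  shows "sum w Z - L * card Z \<le> B * card {z \<in> Z. L \<le> w z}"
proof -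
  let ?G = "{z \<in> Z. L \<le> w z}"
  have "sum w Z = sum w ?G + sum w (Z - ?G)"
    using assms(1) by (simp add: sum.subset_diff[of ?G Z w] add.commute)
  moreover have "sum w ?G \<le> real (card ?G) * B"
    by (rule sum_bounded_above) (use assms in auto)
  moreover have "sum w (Z - ?G) \<le> real (card (Z - ?G)) * L"
    by (rule sum_bounded_above) auto
  moreover have "real (card (Z - ?G)) * L \<le> real (card Z) * L"
    using assms by (intro mult_right_mono) (auto intro!: card_mono)
  ultimately show ?thesis by (simp add: mult.commute)
qed

lemma card_quadratic_roots_le:
  fixes a b c :: "'a::idom"
  assumes "a \<noteq> 0"
  shows "card {s. a * s\<^sup>2 + b * s + c = 0} \<le> 2"
proof -
  have "card {s. poly [:c, b, a:] s = 0} \<le> degree [:c, b, a:]"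
    using assms by (intro card_poly_roots_bound) auto
  moreover have "{s. poly [:c, b, a:] s = 0} = {s. a * s\<^sup>2 + b * s + c = 0}"
    by (auto simp: algebra_simps power2_eq_square)
  ultimately show ?thesis using assms by simp
qed

section \<open>Nondegenerate quadratic forms over a finite field of odd order\<close>

locale finite_quadratic_space =
  fixes Q :: "'a::{field,finite} ^ 'n \<Rightarrow> 'a"
  assumes odd_card: "odd CARD('a)"
    and quadratic: "quadratic_form Q"
    and nondeg: "nondegenerate Q"
begin

lemma two_neq_zero: "(2::'a) \<noteq> 0"
  by (rule two_neq_zero_of_odd_card[OF odd_card])

text \<open>The coefficient matrix need not be symmetric, so \<open>B\<close> need not be the polar
  form. It serves only to derive the rules for \<open>polar Q\<close> and \<open>Q\<close>
  below.\<close>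

lemma bilinear_exists:
  obtains B :: "'a ^ 'n \<Rightarrow> 'a ^ 'n \<Rightarrow> 'a" where
    "\<And>x y z. B (x + y) z = B x z + B y z" "\<And>x y z. B x (y + z) = B x y + B x z"
    "\<And>c x y. B (c *s x) y = c * B x y" "\<And>c x y. B x (c *s y) = c * B x y"
    "\<And>x. Q x = B x x"
proof -
  obtain A :: "'a ^ 'n ^ 'n" where
    A: "\<And>x. Q x = (\<Sum>i\<in>UNIV. \<Sum>j\<in>UNIV. A $ i $ j * x $ i * x $ j)"
    using quadratic unfolding quadratic_form_def by blast
  let ?B = "\<lambda>x y. \<Sum>i\<in>UNIV. \<Sum>j\<in>UNIV. A $ i $ j * x $ i * y $ j"
  show ?thesis
    by (rule that[of ?B])
      (simp_all add: A sum.distrib sum_distrib_left algebra_simps)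
qed

lemma polar_sym: "polar Q x y = polar Q y x"
  by (simp add: polar_def algebra_simps)

text \<open>The polar form is the symmetrisation of \<open>B\<close>, whence its linearity. The
  expansion of \<open>Q (x + y)\<close> is where 2 has to be invertible.\<close>

lemma polar_add_left: "polar Q (x + y) z = polar Q x z + polar Q y z"
  and polar_scale_left: "polar Q (c *s x) z = c * polar Q x z"
  and form_scale: "Q (c *s x) = c\<^sup>2 * Q x"
  and form_add: "Q (x + y) = Q x + 2 * polar Q x y + Q y"
proof -
  obtain B where B: "\<And>x y z. B (x + y) z = B x z + B y z" "\<And>x y z. B x (y + z) = B x y + B x z"
    "\<And>c x y. B (c *s x) y = c * B x y" "\<And>c x y. B x (c *s y) = c * B x y"
    "\<And>x. Q x = B x x"
    by (rule bilinear_exists) blast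
  have polar: "polar Q x y = (B x y + B y x) / 2" for x y
    by (simp add: polar_def B algebra_simps)
  show "polar Q (x + y) z = polar Q x z + polar Q y z"
    unfolding polar B by (simp add: add_divide_distrib algebra_simps)
  show "polar Q (c *s x) z = c * polar Q x z"
    unfolding polar B by (simp add: algebra_simps)
  show "Q (c *s x) = c\<^sup>2 * Q x"
    by (simp add: B power2_eq_square algebra_simps)
  show "Q (x + y) = Q x + 2 * polar Q x y + Q y"
    unfolding polar_def times_divide_eq_right
    by (simp only: nonzero_mult_div_cancel_left[OF two_neq_zero]) simp
qed

lemma polar_add_right: "polar Q x (y + z) = polar Q x y + polar Q x z"
  using polar_add_left[of y z x] by (simp add: polar_sym)

lemma polar_scale_right: "polar Q x (c *s y) = c * polar Q x y"
  using polar_scale_left[of c y x] by (simp add: polar_sym)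

lemma polar_diff_left: "polar Q (x - y) z = polar Q x z - polar Q y z"
  using polar_add_left[of "x - y" y z] by simp

lemma polar_diff_right: "polar Q x (y - z) = polar Q x y - polar Q x z"
  using polar_add_right[of x "y - z" z] by simp

lemma form_diff: "Q (x - y) = Q x - 2 * polar Q x y + Q y"
proof -
  have "Q y = polar Q y y"
    using form_add[of y y] form_scale[of 2 y] two_neq_zero
    by (simp add: vector_sadd_rdistrib[of 1 1 y, simplified] power2_eq_square)
  then show ?thesis
    using form_add[of "x - y" y] by (simp add: polar_diff_left algebra_simps)
qed

lemma obtain_polar_neq_zero:
  assumes "a \<noteq> 0"
  obtains v where "polar Q a v \<noteq> 0"
  using assms nondeg unfolding nondegenerate_def by blast

section \<open>Points in hyperplanes and in intersections of two spheres\<close>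

lemma qsphere_inter_subset_radical_hyperplane:
  "qsphere Q c r \<inter> qsphere Q c' r' \<subseteq> radical_hyperplane Q c r c' r'"
proof -
  \<comment> \<open>Subtracting the two sphere equations cancels \<open>Q x\<close>, leaving a
    condition linear in \<open>x\<close>.\<close>
  have "2 * polar Q (c' - c) x = (Q (x - c) - Q (x - c')) - Q c + Q c'" for x
    by (simp add: form_diff polar_diff_left polar_sym[of x] algebra_simps)
  then show ?thesis
    by (auto simp: qsphere_def radical_hyperplane_def)
qed

text \<open>For a vector \<open>v\<close> not orthogonal to \<open>a\<close>, the translates of the
  hyperplane by the multiples of \<open>v\<close> are pairwise disjoint, so \<open>CARD('a)\<close>
  copies of it fit into the whole space.\<close>

lemma card_hyperplane_le:
  assumes "a \<noteq> 0"
  shows "card {x. polar Q a x = k} \<le> CARD('a) ^ (CARD('n) - 1)"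
proof -
  obtain v where v: "polar Q a v \<noteq> 0"
    using obtain_polar_neq_zero[OF assms] .
  let ?H = "{x. polar Q a x = k}"
  have "inj_on (\<lambda>(x, u). x + u *s v) (?H \<times> UNIV)"
  proof (rule inj_onI, clarify)
    fix x u y u'
    assume eq: "x + u *s v = y + u' *s v" and "polar Q a y = polar Q a x" "k = polar Q a x"
    moreover have "polar Q a x + u * polar Q a v = polar Q a y + u' * polar Q a v"
      using arg_cong[OF eq, of "polar Q a"] by (simp only: polar_add_right polar_scale_right)
    ultimately have "u * polar Q a v = u' * polar Q a v"
      by simp
    then show "x = y \<and> u = u'" using v eq by simp
  qed
  then have "card (?H \<times> (UNIV :: 'a set)) \<le> CARD('a ^ 'n)"
    by (rule card_inj_on_le) auto
  moreover have "CARD('n) = Suc (CARD('n) - 1)" by simp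
  then have "CARD('a ^ 'n) = CARD('a) ^ (CARD('n) - 1) * CARD('a)"
    by (metis CARD_vec power_Suc2)
  ultimately show ?thesis by (simp add: card_cartesian_product)
qed

text \<open>Here \<open>d \<ge> 3\<close> enters: two linear conditions have a nonzero common solution, which would lie
  in the radical if the hyperplane were totally isotropic.\<close>

lemma anisotropic_in_hyperplane:
  assumes "CARD('n) \<ge> 3" "a \<noteq> 0"
  obtains w where "polar Q a w = 0" "Q w \<noteq> 0"
proof (rule ccontr)
  assume "\<not> thesis"
  then have iso: "Q w = 0" if "polar Q a w = 0" for w
    using that \<open>\<And>w. polar Q a w = 0 \<Longrightarrow> Q w \<noteq> 0 \<Longrightarrow> thesis\<close> by blast
  obtain v where v: "polar Q a v \<noteq> 0"
    using obtain_polar_neq_zero[OF assms(2)] .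
  have q: "CARD('a) > 1"
    using card_mono[of UNIV "{0, 1::'a}"] by simp
  \<comment> \<open>Pigeonhole: the dimension is at least 3, and there are only
    \<open>CARD('a) ^ 2\<close> pairs of values.\<close>
  have "\<not> inj (\<lambda>x. (polar Q a x, polar Q v x))"
  proof
    assume "inj (\<lambda>x. (polar Q a x, polar Q v x))"
    then have "CARD('a ^ 'n) \<le> CARD('a \<times> 'a)"
      by (rule card_inj_on_le) auto
    then have "CARD('a) ^ CARD('n) \<le> CARD('a) ^ 2"
      by (simp add: power2_eq_square)
    with q assms(1) show False
      by (simp add: power_increasing_iff)
  qed
  then obtain x y where "x \<noteq> y" "polar Q a x = polar Q a y" "polar Q v x = polar Q v y"
    by (auto simp: inj_on_def)
  then have w: "x - y \<noteq> 0" "polar Q a (x - y) = 0" "polar Q v (x - y) = 0"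
    by (auto simp: polar_diff_right)
  have "polar Q (x - y) z = 0" for z
  proof -
    \<comment> \<open>This coefficient makes \<open>z - e *s v\<close> orthogonal to
      \<open>a\<close>. Two isotropic vectors with isotropic sum are orthogonal, so
      \<open>x - y\<close> is orthogonal to that part of \<open>z\<close>, and it is orthogonal to
      \<open>v\<close> by choice.\<close>
    define e where "e = polar Q a z / polar Q a v"
    define z' where "z' = z - e *s v"
    have z': "polar Q a z' = 0"
      using v by (simp add: z'_def e_def polar_diff_right polar_scale_right)
    then have "polar Q a (x - y + z') = 0"
      using w by (simp add: polar_add_right)
    from iso[OF this] iso[OF w(2)] iso[OF z'] have "polar Q (x - y) z' = 0"
      by (simp add: polar_def)
    moreover have "polar Q (x - y) z = polar Q (x - y) z' + e * polar Q v (x - y)"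
      by (simp add: z'_def polar_diff_left polar_diff_right polar_scale_right
          polar_sym[of v] algebra_simps)
    ultimately show ?thesis using w by simp
  qed
  with w nondeg show False
    unfolding nondegenerate_def by blast
qed

text \<open>Move each point of the intersection by all combinations of \<open>w\<close>, a direction
  of the hyperplane, and \<open>v\<close>, a direction leaving it. A given \<open>y\<close> is
  reached at most twice: the coefficient of \<open>v\<close> is determined by
  \<open>polar Q a y\<close>, and that of \<open>w\<close> is a root of a polynomial with leading
  coefficient \<open>Q w\<close>, which is nonzero.\<close>

lemma card_hyperplane_inter_qsphere_le:
  assumes "CARD('n) \<ge> 3" "a \<noteq> 0"
  shows "card ({x. polar Q a x = k} \<inter> qsphere Q p t) \<le> 2 * CARD('a) ^ (CARD('n) - 2)"
proof -
  obtain v where v: "polar Q a v \<noteq> 0"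
    using obtain_polar_neq_zero[OF assms(2)] .
  obtain w where w: "polar Q a w = 0" "Q w \<noteq> 0"
    using anisotropic_in_hyperplane[OF assms] .
  let ?A = "({x. polar Q a x = k} \<inter> qsphere Q p t)"
  let ?g = "\<lambda>(x, s, u). x + s *s w + u *s v"
  let ?D = "?A \<times> (UNIV :: 'a set) \<times> (UNIV :: 'a set)"
  have "card {z \<in> ?D. ?g z = y} \<le> 2" for y
  proof -
    \<comment> \<open>The only possible coefficient of \<open>v\<close>, found by applying
      \<open>polar Q a\<close> to \<open>y = x + s *s w + u *s v\<close>.\<close>
    define e where "e = (polar Q a y - k) / polar Q a v"
    define y' where "y' = y - e *s v - p"
    let ?R = "{s. Q w * s\<^sup>2 + (- 2 * polar Q y' w) * s + (Q y' - t) = 0}"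
    have "{z \<in> ?D. ?g z = y} \<subseteq> (\<lambda>s. (y - s *s w - e *s v, s, e)) ` ?R"
    proof
      fix z
      assume "z \<in> {z \<in> ?D. ?g z = y}"
      then obtain x s u where x: "polar Q a x = k" "x \<in> qsphere Q p t"
          and y: "y = x + s *s w + u *s v" and z: "z = (x, s, u)"
        by auto
      have u: "u = e"
        using v w by (simp add: e_def y x polar_add_right polar_scale_right)
      have "x - p = y' - s *s w" by (simp add: y'_def y u)
      then have "Q (y' - s *s w) = t"
        using x by (simp add: qsphere_def)
      then have "s \<in> ?R"
        by (simp add: form_diff form_scale polar_scale_right algebra_simps)
      then show "z \<in> (\<lambda>s. (y - s *s w - e *s v, s, e)) ` ?R"
        by (rule rev_image_eqI) (simp add: u y z)
    qed
    then have "card {z \<in> ?D. ?g z = y} \<le> card ?R"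
      by (rule surj_card_le[rotated]) simp
    also have "\<dots> \<le> 2"
      using w by (intro card_quadratic_roots_le) simp
    finally show ?thesis .
  qed
  then have "card ?D \<le> 2 * CARD('a ^ 'n)"
    by (intro card_le_mult_fibres[where g = ?g]) auto
  moreover have "CARD('n) = Suc (Suc (CARD('n) - 2))"
    using assms by simp
  then have "CARD('a ^ 'n) = CARD('a) ^ (CARD('n) - 2) * (CARD('a) * CARD('a))"
    by (metis CARD_vec power_Suc2 mult.assoc)
  ultimately have "card ?A * (CARD('a) * CARD('a))
      \<le> (2 * CARD('a) ^ (CARD('n) - 2)) * (CARD('a) * CARD('a))"
    by (simp add: card_cartesian_product)
  then show ?thesis by (subst (asm) mult_le_cancel2) simp
qed

lemma radical_hyperplane_eq:
  "radical_hyperplane Q c r c' r' = {x. polar Q (c' - c) x = ((r - r') - Q c + Q c') / 2}"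
  using two_neq_zero by (auto simp: radical_hyperplane_def field_simps)

lemma card_qsphere_inter_le:
  assumes "c \<noteq> c'"
  shows "card (qsphere Q c r \<inter> qsphere Q c' r') \<le> CARD('a) ^ (CARD('n) - 1)"
proof -
  have "card (qsphere Q c r \<inter> qsphere Q c' r') \<le> card (radical_hyperplane Q c r c' r')"
    by (intro card_mono qsphere_inter_subset_radical_hyperplane) simp
  also have "\<dots> \<le> CARD('a) ^ (CARD('n) - 1)"
    unfolding radical_hyperplane_eq using assms by (intro card_hyperplane_le) simp
  finally show ?thesis .
qed

lemma card_qsphere_inter_le':
  assumes "CARD('n) \<ge> 3" "c \<noteq> c'"
  shows "card (qsphere Q c r \<inter> qsphere Q c' r') \<le> 2 * CARD('a) ^ (CARD('n) - 2)"
proof -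
  have "card (qsphere Q c r \<inter> qsphere Q c' r')
      \<le> card (radical_hyperplane Q c r c' r' \<inter> qsphere Q c r)"
    by (intro card_mono) (use qsphere_inter_subset_radical_hyperplane in auto)
  also have "\<dots> \<le> 2 * CARD('a) ^ (CARD('n) - 2)"
    unfolding radical_hyperplane_eq using assms
    by (intro card_hyperplane_inter_qsphere_le) auto
  finally show ?thesis .
qed

end

section \<open>Double count of points against pairs of pins with radii\<close>

text \<open>Pairs are indexed by pins and radii rather than by spheres as point sets, so equal
  intersections count separately. Only attained radii occur, which is what keeps the number of pairs
  small.\<close>

definition pin_radius_pairs ::
    "('a::field ^ 'n \<Rightarrow> 'a) \<Rightarrow> ('a ^ 'n) set \<Rightarrow> ('a ^ 'n) set \<Rightarrow>
      ((('a ^ 'n) \<times> 'a) \<times> (('a ^ 'n) \<times> 'a)) set" where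
  "pin_radius_pairs Q P T =
     {((p, t), (p', t')). p \<in> T \<and> p' \<in> T \<and> p \<noteq> p' \<and>
        t \<in> pinned_distances Q P p \<and> t' \<in> pinned_distances Q P p'}"

lemma card_offdiag:
  assumes "finite T"
  shows "real (card {(p, p'). p \<in> T \<and> p' \<in> T \<and> p \<noteq> p'}) = real (card T) * (real (card T) - 1)"
proof -
  have "{(p, p'). p \<in> T \<and> p' \<in> T \<and> p \<noteq> p'} = (SIGMA p:T. T - {p})"
    by auto
  then have "card {(p, p'). p \<in> T \<and> p' \<in> T \<and> p \<noteq> p'} = (\<Sum>p\<in>T. card T - 1)"
    using assms by simp
  then show ?thesis
    \<comment> \<open>The empty set is treated apart because \<open>card T - 1\<close> is a
      truncated subtraction.\<close>
    using assms by (cases "T = {}") (auto simp: of_nat_diff Suc_le_eq card_gt_0_iff)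
qed

text \<open>Two distinct pins and a point of \<open>P\<close> determine both radii. The
  intersections are the fibres of the resulting map, so their sizes add up to the size of its
  domain.\<close>

lemma sum_card_inter_pin_radius_pairs:
  fixes Q :: "'a::{field,finite} ^ 'n \<Rightarrow> 'a"
  shows "(\<Sum>((p, t), (p', t'))\<in>pin_radius_pairs Q P T.
      real (card (P \<inter> qsphere Q p t \<inter> qsphere Q p' t')))
    = real (card P) * (real (card T) * (real (card T) - 1))"
proof -
  let ?D = "{(p, p'). p \<in> T \<and> p' \<in> T \<and> p \<noteq> p'}"
  let ?g = "\<lambda>((p, p'), x). ((p, Q (x - p)), (p', Q (x - p')))"
  have fibre: "card {z \<in> ?D \<times> P. ?g z = ((p, t), (p', t'))}
      = card (P \<inter> qsphere Q p t \<inter> qsphere Q p' t')"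
    if "((p, t), (p', t')) \<in> pin_radius_pairs Q P T" for p t p' t'
  proof -
    have "{z \<in> ?D \<times> P. ?g z = ((p, t), (p', t'))}
        = (\<lambda>x. ((p, p'), x)) ` (P \<inter> qsphere Q p t \<inter> qsphere Q p' t')"
      using that by (auto simp: pin_radius_pairs_def qsphere_def)
    then show ?thesis by (simp add: card_image inj_on_def)
  qed
  have "(\<Sum>((p, t), (p', t'))\<in>pin_radius_pairs Q P T.
        real (card (P \<inter> qsphere Q p t \<inter> qsphere Q p' t')))
      = (\<Sum>y\<in>pin_radius_pairs Q P T. \<Sum>z\<in>{z \<in> ?D \<times> P. ?g z = y}. 1)"
    by (intro sum.cong) (auto simp: fibre)
  also have "\<dots> = real (card (?D \<times> P))"
    by (subst sum.group) (auto simp: pin_radius_pairs_def pinned_distances_def)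
  also have "\<dots> = real (card P) * (real (card T) * (real (card T) - 1))"
    using card_offdiag[of T] by (simp add: card_cartesian_product mult.commute)
  finally show ?thesis .
qed

lemma card_pin_radius_pairs_le:
  fixes Q :: "'a::{field,finite} ^ 'n \<Rightarrow> 'a"
  assumes "\<And>p. p \<in> T \<Longrightarrow> real (card (pinned_distances Q P p)) \<le> K"
  shows "real (card (pin_radius_pairs Q P T)) \<le> K\<^sup>2 * (real (card T) * (real (card T) - 1))"
proof -
  let ?D = "{(p, p'). p \<in> T \<and> p' \<in> T \<and> p \<noteq> p'}"
  let ?R = "pinned_distances Q P"
  let ?S = "SIGMA (p, p'):?D. ?R p \<times> ?R p'"
  have "pin_radius_pairs Q P T = (\<lambda>((p, p'), (t, t')). ((p, t), (p', t'))) ` ?S"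
    by (force simp: pin_radius_pairs_def)
  then have "card (pin_radius_pairs Q P T) \<le> card ?S"
    by (simp only: card_image_le finite)
  also have "\<dots> = (\<Sum>(p, p')\<in>?D. card (?R p) * card (?R p'))"
    by (subst card_SigmaI) (auto simp: card_cartesian_product intro!: sum.cong)
  finally have "real (card (pin_radius_pairs Q P T))
      \<le> (\<Sum>(p, p')\<in>?D. real (card (?R p)) * real (card (?R p')))"
    by (simp add: case_prod_unfold flip: of_nat_mult of_nat_sum)
  also have "\<dots> \<le> real (card ?D) * K\<^sup>2"
    unfolding power2_eq_square
    \<comment> \<open>\<open>K\<close> is nonnegative as soon as there is a pin, since it then
      bounds a cardinality.\<close>
    by (rule sum_bounded_above) (auto intro!: mult_mono assms order_trans[OF of_nat_0_le_iff assms])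
  finally show ?thesis
    using card_offdiag[of T] by (simp add: mult.commute)
qed

section \<open>Comparison of the threshold with the average\<close>

text \<open>The left side is the threshold times the maximal number of radius pairs for one pair of
  pins. Squaring removes the roots and brings out the factor
  \<open>(1 - \<alpha>) ^ 3 * m * q ^ 3\<close> bounded by the hypothesis; then \<open>C\<close>
  cancels and \<open>\<alpha> < 1\<close> suffices.\<close>

lemma threshold_le:
  fixes \<alpha> C m n q :: real
  assumes "0 < \<alpha>" "\<alpha> < 1" "1 \<le> C" "0 \<le> m" "0 \<le> n" "0 < q"
    and "(1 - \<alpha>) ^ 3 * m * q ^ 3 \<le> C\<^sup>2 * \<alpha>\<^sup>2 * n"
  shows "\<alpha> / (8 * C * sqrt (1 - \<alpha>)) * sqrt (m * n / q) * ((1 - \<alpha>) * q)\<^sup>2 \<le> n / 8"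
proof -
  define s where "s = 1 - \<alpha>"
  have s: "s > 0" using assms by (simp add: s_def)
  let ?L = "\<alpha> / (C * sqrt s) * sqrt (m * n / q) * (s * q)\<^sup>2"
  have "?L\<^sup>2 = \<alpha>\<^sup>2 * n * (s ^ 3 * m * q ^ 3) / C\<^sup>2"
  proof -
    have "?L\<^sup>2 = \<alpha>\<^sup>2 / (C\<^sup>2 * s) * (m * n / q) * (s * q) ^ 4"
      using s assms by (simp add: power_mult_distrib power_divide flip: power_mult)
    also have "\<dots> = \<alpha>\<^sup>2 * n * (s ^ 3 * m * q ^ 3) / C\<^sup>2"
      using s assms by (simp add: field_simps eval_nat_numeral)
    finally show ?thesis .
  qed
  also have "\<dots> \<le> \<alpha>\<^sup>2 * n * (C\<^sup>2 * \<alpha>\<^sup>2 * n) / C\<^sup>2"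
    using assms by (intro divide_right_mono mult_left_mono) (auto simp: s_def)
  also have "\<dots> = (\<alpha>\<^sup>2 * n)\<^sup>2"
    using assms by (simp add: power2_eq_square)
  also have "\<dots> \<le> n\<^sup>2"
  proof -
    have "\<alpha>\<^sup>2 \<le> 1" using assms by (simp add: power_le_one)
    then show ?thesis using assms by (intro power_mono mult_left_le_one_le) auto
  qed
  finally have "?L \<le> n"
    by (rule power2_le_imp_le) (use assms in simp)
  then show ?thesis by (simp add: s_def)
qed

section \<open>Existence and number of rich intersections\<close>

theorem theorem5p4:
  fixes Q :: "'a::{field,finite} ^ 'n \<Rightarrow> 'a"
    and P T :: "('a ^ 'n) set"
    and q d m :: nat
    and \<alpha> C\<^sub>1 :: real
  assumes "q = CARD('a)" and "odd q"
    and "d = CARD('n)" and "d \<ge> 2"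
    and "quadratic_form Q" and "nondegenerate Q"
    and "P \<noteq> {}"
    and "card T = m" and "m \<ge> 2"
    and "0 < \<alpha>" and "\<alpha> < 1"
    and "\<And>p. p \<in> T \<Longrightarrow> real (card (pinned_distances Q P p)) \<le> (1 - \<alpha>) * real q"
    and "C\<^sub>1 \<ge> 1"
    and "(1 - \<alpha>) ^ 3 * real m * real q ^ 3 \<le> C\<^sub>1 ^ 2 * \<alpha> ^ 2 * real (card P)"
  shows
    "(\<exists>p\<in>T. \<exists>p'\<in>T. p \<noteq> p' \<and>
       (\<exists>t\<in>pinned_distances Q P p. \<exists>t'\<in>pinned_distances Q P p'.
          real (card (P \<inter> qsphere Q p t \<inter> qsphere Q p' t'))
            \<ge> \<alpha> / (8 * C\<^sub>1 * sqrt (1 - \<alpha>)) * sqrt (real m * real (card P) / real q) \<and>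
          real (card (P \<inter> radical_hyperplane Q p t p' t'))
            \<ge> \<alpha> / (8 * C\<^sub>1 * sqrt (1 - \<alpha>)) * sqrt (real m * real (card P) / real q)))
     \<and>
     (let N = card {((p, t), (p', t')).
            p \<in> T \<and> p' \<in> T \<and> p \<noteq> p' \<and>
            t \<in> pinned_distances Q P p \<and> t' \<in> pinned_distances Q P p' \<and>
            real (card (P \<inter> qsphere Q p t \<inter> qsphere Q p' t'))
              \<ge> \<alpha> / (8 * C\<^sub>1 * sqrt (1 - \<alpha>)) * sqrt (real m * real (card P) / real q)}
      in real N \<ge> 3 * real (card P) * real m * (real m - 1) / (4 * real q ^ (d - 1)) \<and>
         (d \<ge> 3 \<longrightarrow>
           real N \<ge> 3 * real (card P) * real m * (real m - 1) / (8 * real q ^ (d - 2))))"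
proof -
  interpret finite_quadratic_space Q
    using assms(1,2,5,6) by unfold_locales auto
  define L where "L = \<alpha> / (8 * C\<^sub>1 * sqrt (1 - \<alpha>)) * sqrt (real m * real (card P) / real q)"
  define Z where "Z = pin_radius_pairs Q P T"
  define w where "w = (\<lambda>((p, t), (p', t')). real (card (P \<inter> qsphere Q p t \<inter> qsphere Q p' t')))"
  define M where "M = real m * (real m - 1)"
  define G where "G = {z \<in> Z. L \<le> w z}"
  have q: "q > 0" using assms(1) by simp
  have M: "M > 0" using \<open>m \<ge> 2\<close> by (simp add: M_def)
  have P: "real (card P) > 0" using \<open>P \<noteq> {}\<close> by (simp add: card_gt_0_iff)
  have L: "L \<ge> 0" using assms by (simp add: L_def)
  \<comment> \<open>\<open>L * real (card Z)\<close> bounds the contribution of all pairs below the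
    threshold.\<close>
  have "L * real (card Z) \<le> L * (((1 - \<alpha>) * real q)\<^sup>2 * M)"
    using L card_pin_radius_pairs_le[OF assms(12), where T = T]
    by (intro mult_left_mono) (simp_all add: Z_def M_def assms(8))
  also have "\<dots> \<le> real (card P) / 8 * M"
    using threshold_le[of \<alpha> C\<^sub>1 "real m" "real (card P)" "real q"] assms q M
    by (simp only: mult.assoc[symmetric] L_def) (intro mult_right_mono; simp)
  finally have LZ: "L * real (card Z) \<le> real (card P) / 8 * M" .
  have sumw: "sum w Z = real (card P) * M"
    unfolding w_def Z_def M_def sum_card_inter_pin_radius_pairs assms(8) ..
  have many: "3 / 4 * (real (card P) * M) \<le> B * real (card G)"
    if "\<And>z. z \<in> Z \<Longrightarrow> w z \<le> B" for B
  proof -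
    have "sum w Z - L * card Z \<le> B * card G"
      unfolding G_def by (rule card_large_values_ge; use L that in auto)
    \<comment> \<open>Seven eighths of the total remain for \<open>G\<close>; nonnegativity allows
      weakening this to three quarters.\<close>
    moreover have "0 \<le> real (card P) * M" using P M by simp
    ultimately show ?thesis using LZ sumw by simp
  qed
  have w_le: "w ((p, t), (p', t')) \<le> real (card (qsphere Q p t \<inter> qsphere Q p' t'))" for p t p' t'
    unfolding w_def by (auto intro!: card_mono)
  have "w z \<le> real q ^ (d - 1)" if z: "z \<in> Z" for z
  proof -
    obtain p t p' t' where "z = ((p, t), (p', t'))" "p \<noteq> p'"
      using z by (auto simp: Z_def pin_radius_pairs_def)
    then show ?thesis
      using w_le[of p t p' t'] card_qsphere_inter_le[of p p' t t'] assms(1,3)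
      by (metis of_nat_le_iff of_nat_power order_trans)
  qed
  from many[OF this] have N1:
    "3 * real (card P) * real m * (real m - 1) / (4 * real q ^ (d - 1)) \<le> real (card G)"
    using q by (simp add: M_def field_simps)
  have N2: "3 * real (card P) * real m * (real m - 1) / (8 * real q ^ (d - 2)) \<le> real (card G)"
    if d: "d \<ge> 3"
  proof -
    have "w z \<le> 2 * real q ^ (d - 2)" if z: "z \<in> Z" for z
    proof -
      obtain p t p' t' where "z = ((p, t), (p', t'))" "p \<noteq> p'"
        using z by (auto simp: Z_def pin_radius_pairs_def)
      then show ?thesis
        using w_le[of p t p' t'] card_qsphere_inter_le'[of p p' t t'] assms(1,3) d
        by (metis of_nat_le_iff of_nat_power of_nat_mult of_nat_numeral order_trans)
    qed
    \<comment> \<open>The factor 2 in this bound turns the denominator 4 into 8.\<close>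
    from many[OF this] show ?thesis
      using q by (simp add: M_def field_simps)
  qed
  \<comment> \<open>Existence follows from the count: its lower bound is positive.\<close>
  have "0 < 3 * real (card P) * real m * (real m - 1) / (4 * real q ^ (d - 1))"
    using q P \<open>m \<ge> 2\<close> by simp
  with N1 have "G \<noteq> {}" by auto
  then obtain p t p' t' where "((p, t), (p', t')) \<in> G" by auto
  then have pt: "p \<in> T" "p' \<in> T" "p \<noteq> p'" "t \<in> pinned_distances Q P p"
      "t' \<in> pinned_distances Q P p'"
      "L \<le> real (card (P \<inter> qsphere Q p t \<inter> qsphere Q p' t'))"
    by (auto simp: G_def Z_def w_def pin_radius_pairs_def)
  have "card (P \<inter> qsphere Q p t \<inter> qsphere Q p' t') \<le> card (P \<inter> radical_hyperplane Q p t p' t')"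
    by (rule card_mono[OF finite]) (use qsphere_inter_subset_radical_hyperplane in blast)
  with pt(6) have H: "L \<le> real (card (P \<inter> radical_hyperplane Q p t p' t'))" by linarith
  have G: "G = {((p, t), (p', t')).
      p \<in> T \<and> p' \<in> T \<and> p \<noteq> p' \<and>
      t \<in> pinned_distances Q P p \<and> t' \<in> pinned_distances Q P p' \<and>
      real (card (P \<inter> qsphere Q p t \<inter> qsphere Q p' t')) \<ge> L}"
    by (auto simp: G_def Z_def w_def pin_radius_pairs_def)
  show ?thesis
    unfolding L_def[symmetric] Let_def G[symmetric]
  proof (intro conjI impI)
    show "real (card G) \<ge> 3 * real (card P) * real m * (real m - 1) / (4 * real q ^ (d - 1))"
      by (rule N1)
    show "real (card G) \<ge> 3 * real (card P) * real m * (real m - 1) / (8 * real q ^ (d - 2))"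
      if "d \<ge> 3"
      using that by (rule N2)
  qed (rule bexI[OF _ pt(1)], rule bexI[OF _ pt(2)], rule conjI[OF pt(3)],
      rule bexI[OF _ pt(4)], rule bexI[OF _ pt(5)], rule conjI[OF pt(6) H])
qed

end
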